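(* Assume that $f:\mathbb{R}^n\to\mathbb{R}$ is Lipschitz with $\mathrm{LIP}[f]>0$, and that $g:\mathbb{R}^n\to(0,\mathrm{LIP}[f]]$ is a strictly positive lower semicontinuous function which is an upper gradient for $f$, satisfying $g|_{\mathbb{R}^n\setminus B(0,R)}\equiv\mathrm{LIP}[f]$ for some $R>0$. Let $(g_i)_{i=1}^\infty$ be an increasing sequence of continuous functions on $\mathbb{R}^n$ with $g_i\to g$ pointwise and $g_i|_{\mathbb{R}^n\setminus B(0,R)}\equiv\mathrm{LIP}[f]$ for all $i\in\mathbb{N}$. Then there exists a sequence of $\mathrm{LIP}[f]$-Lipschitz functions $f_i:\mathbb{R}^n\to\mathbb{R}$ that converges weak-$*$ to $f$ and for which $$\mathrm{Lip}_a[f_i](x)\le g_i(x)\qquad\text{for all }i\in\mathbb{N}\text{ and all }x\in\mathbb{R}^n.$$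
   Context: $\mathbb{R}^n$ carries the Euclidean distance and $B(x,r)$ is the open ball of radius $r$ centered at $x$. $\mathrm{LIP}[h]$ is the smallest Lipschitz constant of $h$, and $\mathrm{Lip}_a[h](x)=\lim_{r\to0}\mathrm{LIP}[h|_{B(x,r)}]$ is the asymptotic Lipschitz constant of $h$ at $x$. A function is $L$-Lipschitz if its Lipschitz constant is at most $L$. A Borel function $g:\mathbb{R}^n\to[0,\infty]$ is an upper gradient of $f:\mathbb{R}^n\to\mathbb{R}$ if $|f(\gamma(a))-f(\gamma(b))|\le\int_\gamma g\,ds$ for all rectifiable curves $\gamma:[a,b]\to\mathbb{R}^n$, where $\int_\gamma g\,ds$ is the line integral with respect to arc length. A sequence of Lipschitz functions $f_i:\mathbb{R}^n\to\mathbb{R}$ converges weak-$*$ to a Lipschitz function $f$ if $f_i\to f$ pointwise and $\sup_i\mathrm{LIP}[f_i]<\infty$. "Increasing" means $g_i\le g_{i+1}$ for all $i$.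
   Formalization: The functions g_i are additionally assumed nonnegative; without this the claim fails, since Lip_a[f_i] ≥ 0 always, while an early g_i could take negative values inside B(0,R). *)

theory Defs
  imports "HOL-Analysis.Analysis"
begin

text \<open>The value is \<open>\<infinity>\<close> when the function is not Lipschitz on the set.\<close>

definition LIP :: "'a::metric_space set \<Rightarrow> ('a \<Rightarrow> 'b::metric_space) \<Rightarrow> ennreal" where
  "LIP S h = Inf {ennreal L | L. L-lipschitz_on S h}"

lemma lipschitz_on_iff_LIP_le:
  assumes "0 \<le> L"
  shows "L-lipschitz_on S h \<longleftrightarrow> LIP S h \<le> ennreal L"
proof
  assume "L-lipschitz_on S h"
  then show "LIP S h \<le> ennreal L"
    unfolding LIP_def by (intro Inf_lower) auto
next
  assume le: "LIP S h \<le> ennreal L"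
  show "L-lipschitz_on S h"
  proof (rule lipschitz_onI)
    fix x y assume xy: "x \<in> S" "y \<in> S"
    show "dist (h x) (h y) \<le> L * dist x y"
    proof (rule field_le_epsilon)
      fix e :: real assume "0 < e"
      define d where "d = e / (1 + dist x y)"
      have pos: "0 < 1 + dist x y" by (simp add: add_pos_nonneg)
      with \<open>0 < e\<close> have d: "0 < d" by (simp add: d_def)
      have "LIP S h < ennreal (L + d)"
        using le by (rule le_less_trans) (use d assms in \<open>simp add: ennreal_less_iff\<close>)
      then obtain M where M: "M-lipschitz_on S h" "ennreal M < ennreal (L + d)"
        unfolding LIP_def Inf_less_iff by auto
      have "0 \<le> M" using M(1) by (rule lipschitz_on_nonneg)
      with M(2) have "M < L + d" by (simp add: ennreal_less_iff)
      have "dist (h x) (h y) \<le> M * dist x y"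
        using M(1) xy by (rule lipschitz_onD)
      also have "\<dots> \<le> (L + d) * dist x y"
        using \<open>M < L + d\<close> by (intro mult_right_mono) auto
      also have "\<dots> = L * dist x y + d * dist x y" by (simp add: algebra_simps)
      also have "d * dist x y \<le> d * (1 + dist x y)"
        using d by (intro mult_left_mono) auto
      also have "d * (1 + dist x y) = e" using pos by (simp add: d_def)
      finally show "dist (h x) (h y) \<le> L * dist x y + e" by simp
    qed
  qed (rule assms)
qed

lemma LIP_mono: "S \<subseteq> T \<Longrightarrow> LIP S h \<le> LIP T h"
  unfolding LIP_def by (intro Inf_superset_mono) (auto intro: lipschitz_on_subset)

definition Lip_a :: "('a::metric_space \<Rightarrow> 'b::metric_space) \<Rightarrow> 'a \<Rightarrow> ennreal" where
  "Lip_a h x = Lim (at_right 0) (\<lambda>r. LIP (ball x r) h)"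

text \<open>By monotonicity in \<open>r\<close> the limit always exists.\<close>

lemma tendsto_Lip_a: "((\<lambda>r. LIP (ball x r) h) \<longlongrightarrow> Lip_a h x) (at_right 0)"
proof -
  let ?l = "INF r\<in>{0<..}. LIP (ball x r) h"
  have "((\<lambda>r. LIP (ball x r) h) \<longlongrightarrow> ?l) (at_right 0)"
  proof (rule order_tendstoI)
    fix c assume c: "c < ?l"
    have "c < LIP (ball x r) h" if "0 < r" for r
      using c that by (meson INF_lower greaterThan_iff less_le_trans)
    then show "\<forall>\<^sub>F r in at_right 0. c < LIP (ball x r) h"
      by (auto simp: eventually_at_right_field intro!: exI[of _ 1])
  next
    fix c assume "?l < c"
    then obtain r where r: "0 < r" "LIP (ball x r) h < c"
      by (auto simp: Inf_less_iff)
    have "LIP (ball x s) h < c" if "s < r" for s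
      using LIP_mono[of "ball x s" "ball x r" h] that r(2)
      by (metis le_less_trans less_imp_le subset_ball)
    with r(1) show "\<forall>\<^sub>F r in at_right 0. LIP (ball x r) h < c"
      by (auto simp: eventually_at_right_field)
  qed
  then show ?thesis
    unfolding Lip_a_def by (simp add: tendsto_Lim)
qed

definition lower_semicontinuous :: "('a::topological_space \<Rightarrow> real) \<Rightarrow> bool" where
  "lower_semicontinuous g \<longleftrightarrow> (\<forall>c. open {x. c < g x})"

definition curve_length :: "(real \<Rightarrow> 'a::metric_space) \<Rightarrow> real \<Rightarrow> real \<Rightarrow> ennreal" where
  "curve_length \<gamma> a b =
     (SUP (n, t) \<in> {(n::nat, t::nat \<Rightarrow> real). t 0 = a \<and> t n = b \<and> (\<forall>i<n. t i \<le> t (Suc i))}.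
        \<Sum>i<n. ennreal (dist (\<gamma> (t i)) (\<gamma> (t (Suc i)))))"

definition rectifiable_curve :: "(real \<Rightarrow> 'a::metric_space) \<Rightarrow> real \<Rightarrow> real \<Rightarrow> bool" where
  "rectifiable_curve \<gamma> a b \<longleftrightarrow> a \<le> b \<and> continuous_on {a..b} \<gamma> \<and> curve_length \<gamma> a b < \<infinity>"

text \<open>For a rectifiable curve the length function \<open>t \<mapsto> curve_length \<gamma> a t\<close> maps
  \<open>{a..b}\<close> onto \<open>[0, curve_length \<gamma> a b]\<close>, and \<open>\<gamma>\<close> is constant on its level sets, so the
  choice of \<open>t\<close> does not matter.\<close>

definition arclength_param :: "(real \<Rightarrow> 'a::metric_space) \<Rightarrow> real \<Rightarrow> real \<Rightarrow> real \<Rightarrow> 'a" where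
  "arclength_param \<gamma> a b s = \<gamma> (SOME t. t \<in> {a..b} \<and> curve_length \<gamma> a t = ennreal s)"

definition line_integral ::
    "(real \<Rightarrow> 'a::metric_space) \<Rightarrow> real \<Rightarrow> real \<Rightarrow> ('a \<Rightarrow> ennreal) \<Rightarrow> ennreal" where
  "line_integral \<gamma> a b g =
     (\<integral>\<^sup>+ s \<in> {0..enn2real (curve_length \<gamma> a b)}. g (arclength_param \<gamma> a b s) \<partial>lborel)"

definition upper_gradient :: "('a::metric_space \<Rightarrow> ennreal) \<Rightarrow> ('a \<Rightarrow> real) \<Rightarrow> bool" where
  "upper_gradient g f \<longleftrightarrow> g \<in> borel_measurable borel \<and>
     (\<forall>\<gamma> a b. rectifiable_curve \<gamma> a b \<longrightarrow>
        ennreal \<bar>f (\<gamma> a) - f (\<gamma> b)\<bar> \<le> line_integral \<gamma> a b g)"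

definition weak_star_converges ::
    "(nat \<Rightarrow> 'a::metric_space \<Rightarrow> real) \<Rightarrow> ('a \<Rightarrow> real) \<Rightarrow> bool" where
  "weak_star_converges F f \<longleftrightarrow>
     (\<forall>i. \<exists>L. L-lipschitz_on UNIV (F i)) \<and> (\<exists>L. L-lipschitz_on UNIV f) \<and>
     (\<forall>x. (\<lambda>i. F i x) \<longlonglongrightarrow> f x) \<and> (SUP i. LIP UNIV (F i)) < \<infinity>"

end

theory Submission
  imports Defs "HOL-Complex_Analysis.Great_Picard"
begin

text \<open>
  Let \<open>f\<^sub>i(x)\<close> be the infimum of \<open>f(\<gamma>(T)) + \<integral>\<^bsub>[0,T]\<^esub> g\<^sub>i(\<gamma>(s)) ds\<close> over all 1-Lipschitz curves \<open>\<gamma>\<close>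
  starting at \<open>x\<close> and all \<open>T \<ge> 0\<close>. Prepending a segment to a curve gives
  \<open>f\<^sub>i(u) - f\<^sub>i(v) \<le> K |u - v|\<close> whenever \<open>g\<^sub>i \<le> K\<close> on the segment \<open>[u,v]\<close>, which yields both
  Lipschitz bounds. The sequence \<open>f\<^sub>i(x)\<close> increases and is at most \<open>f(x)\<close>. If its limit were smaller,
  there would be curves of cost at most \<open>f(x) - \<epsilon>\<close> for every \<open>i\<close>. They may be stopped when they last
  leave the ball, since outside of it \<open>g\<^sub>i = LIP[f]\<close>; as \<open>g\<^sub>i\<close> is eventually bounded away from \<open>0\<close>, the
  times \<open>T\<close> are then bounded. By Arzela-Ascoli a subsequence converges to a curve \<open>\<gamma>\<close> with
  \<open>f(\<gamma>(T)) + \<integral> g\<^sub>j(\<gamma>(s)) ds \<le> f(x) - \<epsilon>\<close> for all \<open>j\<close>. Since arc length grows at most as fast as the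
  parameter, the line integral of \<open>g\<^sub>j\<close> along \<open>\<gamma>\<close> is no larger than this integral, and letting
  \<open>j \<rightarrow> \<infinity>\<close> contradicts that \<open>g\<close> is an upper gradient of \<open>f\<close>.
\<close>

section \<open>Line integrals along 1-Lipschitz curves\<close>

lemma curve_length_refl: "curve_length \<gamma> a a = 0"
proof -
  have "(\<Sum>i<n. ennreal (dist (\<gamma> (t i)) (\<gamma> (t (Suc i))))) = 0"
    if t: "t 0 = a" "t n = a" "\<forall>i<n. t i \<le> t (Suc i)" for n and t :: "nat \<Rightarrow> real"
  proof -
    have le: "t j \<le> t k" if "j \<le> k" "k \<le> n" for j k
      using that
    proof (induction k rule: dec_induct)
      case (step m)
      then show ?case using t(3) by (meson Suc_le_lessD less_imp_le order_trans)
    qed simp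
    have "t j = a" if "j \<le> n" for j
      using le[of 0 j] le[of j n] that t by auto
    then show ?thesis by auto
  qed
  then show ?thesis
    unfolding curve_length_def by (intro antisym SUP_least) auto
qed

text \<open>A partition of \<open>[a,s]\<close> becomes one of \<open>[a,t]\<close> by appending the
  point \<open>t\<close>.\<close>

lemma curve_length_extend:
  assumes "a \<le> s" "s \<le> t"
  shows "curve_length \<gamma> a s + ennreal (dist (\<gamma> s) (\<gamma> t)) \<le> curve_length \<gamma> a t"
proof -
  let ?P = "\<lambda>s. {(n::nat, u::nat \<Rightarrow> real). u 0 = a \<and> u n = s \<and> (\<forall>i<n. u i \<le> u (Suc i))}"
  let ?S = "\<lambda>(n, u). \<Sum>i<n. ennreal (dist (\<gamma> (u i)) (\<gamma> (u (Suc i))))"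
  have ne: "?P s \<noteq> {}"
  proof -
    have "(1, \<lambda>i. if i = 0 then a else s) \<in> ?P s" using assms by auto
    then show ?thesis by blast
  qed
  have "curve_length \<gamma> a s + ennreal (dist (\<gamma> s) (\<gamma> t))
      = (SUP p\<in>?P s. ?S p + ennreal (dist (\<gamma> s) (\<gamma> t)))"
    unfolding curve_length_def by (subst ennreal_SUP_add_left[OF ne]) auto
  also have "\<dots> \<le> curve_length \<gamma> a t"
  proof (rule SUP_least)
    fix p assume "p \<in> ?P s"
    then obtain n u where p: "p = (n, u)" and u: "u 0 = a" "u n = s" "\<forall>i<n. u i \<le> u (Suc i)"
      by auto
    define v where "v = u(Suc n := t)"
    have "(Suc n, v) \<in> ?P t"
      using u assms by (auto simp: v_def less_Suc_eq)
    then have "?S (Suc n, v) \<le> curve_length \<gamma> a t"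
      unfolding curve_length_def by (rule SUP_upper)
    moreover have "?S (Suc n, v) = ?S p + ennreal (dist (\<gamma> s) (\<gamma> t))"
      using u by (simp add: p v_def del: sum_ennreal)
    ultimately show "?S p + ennreal (dist (\<gamma> s) (\<gamma> t)) \<le> curve_length \<gamma> a t" by simp
  qed
  finally show ?thesis .
qed

text \<open>Together with \<open>curve_length_extend\<close> this squeezes the growth of length
  between the chord and the parameter increment. The case \<open>s = a\<close> shows that the length
  is finite.\<close>

lemma curve_length_lipschitz_step:
  assumes lip: "1-lipschitz_on {a..b} \<gamma>" and st: "a \<le> s" "s \<le> t" "t \<le> b"
  shows "curve_length \<gamma> a t \<le> curve_length \<gamma> a s + ennreal (t - s)"
  unfolding curve_length_def[of \<gamma> a t]
proof (rule SUP_least, clarify)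
  fix n and u :: "nat \<Rightarrow> real"
  assume u: "a = u 0" "t = u n" "\<forall>i<n. u i \<le> u (Suc i)"
  have le: "u j \<le> u k" if "j \<le> k" "k \<le> n" for j k
    using that
  proof (induction k rule: dec_induct)
    case (step m)
    then show ?case using u(3) by (meson Suc_le_lessD less_imp_le order_trans)
  qed simp
  \<comment> \<open>clipping the partition at \<open>s\<close> splits it into one of \<open>[a,s]\<close> and one of \<open>[s,t]\<close>\<close>
  define p where "p = (\<lambda>i. min (u i) s)"
  define q where "q = (\<lambda>i. max (u i) s)"
  have "(\<Sum>i<n. ennreal (dist (\<gamma> (u i)) (\<gamma> (u (Suc i)))))
      \<le> (\<Sum>i<n. ennreal (dist (\<gamma> (p i)) (\<gamma> (p (Suc i)))) + ennreal (q (Suc i) - q i))"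
  proof (rule sum_mono)
    fix i assume "i \<in> {..<n}"
    then have i: "i < n" by simp
    have b: "a \<le> u i" "u i \<le> u (Suc i)" "u (Suc i) \<le> b"
      using le[of 0 i] le[of "Suc i" n] u st i by auto
    have q: "dist (\<gamma> (q i)) (\<gamma> (q (Suc i))) \<le> q (Suc i) - q i"
      using lipschitz_onD[OF lip, of "q i" "q (Suc i)"] b st
      by (auto simp: q_def dist_real_def)
    \<comment> \<open>The point \<open>\<gamma> s\<close> is inserted only when the interval
      straddles \<open>s\<close>; otherwise one of the two clipped intervals is degenerate.\<close>
    have "dist (\<gamma> (u i)) (\<gamma> (u (Suc i)))
        \<le> dist (\<gamma> (p i)) (\<gamma> (p (Suc i))) + dist (\<gamma> (q i)) (\<gamma> (q (Suc i)))"
      using b(2) dist_triangle[of "\<gamma> (u i)" "\<gamma> (u (Suc i))" "\<gamma> s"]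
      by (auto simp: p_def q_def min_def max_def)
    also have "\<dots> \<le> dist (\<gamma> (p i)) (\<gamma> (p (Suc i))) + (q (Suc i) - q i)"
      using q by simp
    finally show "ennreal (dist (\<gamma> (u i)) (\<gamma> (u (Suc i))))
        \<le> ennreal (dist (\<gamma> (p i)) (\<gamma> (p (Suc i)))) + ennreal (q (Suc i) - q i)"
      using q order_trans[OF zero_le_dist q]
      by (subst ennreal_plus[symmetric]) (auto intro: ennreal_leI simp del: ennreal_plus)
  qed
  also have "\<dots> = (\<Sum>i<n. ennreal (dist (\<gamma> (p i)) (\<gamma> (p (Suc i))))) + (\<Sum>i<n. ennreal (q (Suc i) - q i))"
    by (rule sum.distrib)
  also have "(\<Sum>i<n. ennreal (dist (\<gamma> (p i)) (\<gamma> (p (Suc i))))) \<le> curve_length \<gamma> a s"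
  proof -
    have "(n, p) \<in> {(n, t). t 0 = a \<and> t n = s \<and> (\<forall>i<n. t i \<le> t (Suc i))}"
      using u st by (auto simp: p_def min_def intro: order_trans)
    then show ?thesis
      unfolding curve_length_def by (rule SUP_upper2) simp
  qed
  also have "(\<Sum>i<n. ennreal (q (Suc i) - q i)) = ennreal (\<Sum>i<n. q (Suc i) - q i)"
    using u(3) by (intro sum_ennreal) (auto simp: q_def max_def intro: order_trans)
  also have "(\<Sum>i<n. q (Suc i) - q i) = t - s"
    using u st by (subst sum_lessThan_telescope) (simp add: q_def)
  finally show "(\<Sum>i<n. ennreal (dist (\<gamma> (u i)) (\<gamma> (u (Suc i)))))
      \<le> curve_length \<gamma> (u 0) s + ennreal (u n - s)"
    using u by (simp add: add_right_mono)
qed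

text \<open>Everything rests on \<open>dist (\<gamma> s) (\<gamma> t) \<le> lam t - lam s \<le> t -
  s\<close>. Both bounds make \<open>lam\<close> 1-Lipschitz, hence onto \<open>{0..lam b}\<close>;
  the left one makes \<open>\<gamma>\<close> constant on level sets of \<open>lam\<close>, so the
  arbitrary choice in \<open>arclength_param\<close> is harmless.\<close>

lemma arclength_lipschitz_curve:
  fixes \<gamma> :: "real \<Rightarrow> 'a::metric_space"
  assumes lip: "1-lipschitz_on {a..b} \<gamma>" and ab: "a \<le> b"
  defines "lam \<equiv> \<lambda>t. enn2real (curve_length \<gamma> a t)"
  shows "rectifiable_curve \<gamma> a b"
    and "lam a = 0"
    and "\<And>s t. a \<le> s \<Longrightarrow> s \<le> t \<Longrightarrow> t \<le> b \<Longrightarrow> lam t - lam s \<le> t - s"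
    and "\<And>s t. a \<le> s \<Longrightarrow> s \<le> t \<Longrightarrow> t \<le> b \<Longrightarrow> dist (\<gamma> s) (\<gamma> t) \<le> lam t - lam s"
    and "lam ` {a..b} = {0..lam b}"
    and "\<And>t. t \<in> {a..b} \<Longrightarrow> arclength_param \<gamma> a b (lam t) = \<gamma> t"
    and "1-lipschitz_on {0..lam b} (arclength_param \<gamma> a b)"
proof -
  have fin: "curve_length \<gamma> a t < \<infinity>" if "a \<le> t" "t \<le> b" for t
    using curve_length_lipschitz_step[OF lip order_refl that] 
    by (simp add: curve_length_refl ennreal_less_top order.strict_trans1)
  then have eq: "curve_length \<gamma> a t = ennreal (lam t)" if "a \<le> t" "t \<le> b" for t
    using that by (simp add: lam_def less_top)
  have nn: "0 \<le> lam t" for t by (simp add: lam_def)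
  show "rectifiable_curve \<gamma> a b"
    unfolding rectifiable_curve_def using ab fin lipschitz_on_continuous_on[OF lip] by simp
  show 0: "lam a = 0" by (simp add: lam_def curve_length_refl)
  show up: "lam t - lam s \<le> t - s" if "a \<le> s" "s \<le> t" "t \<le> b" for s t
  proof -
    have "ennreal (lam t) \<le> ennreal (lam s + (t - s))"
      using curve_length_lipschitz_step[OF lip that] that nn by (simp add: eq)
    then show ?thesis using nn[of s] that by (subst (asm) ennreal_le_iff) auto
  qed
  show lo: "dist (\<gamma> s) (\<gamma> t) \<le> lam t - lam s" if "a \<le> s" "s \<le> t" "t \<le> b" for s t
  proof -
    have "ennreal (lam s + dist (\<gamma> s) (\<gamma> t)) \<le> ennreal (lam t)"
      using curve_length_extend[of a s t \<gamma>] that nn by (simp add: eq)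
    then show ?thesis using nn[of t] by (subst (asm) ennreal_le_iff) auto
  qed
  have mono: "lam s \<le> lam t" if "a \<le> s" "s \<le> t" "t \<le> b" for s t
    using lo[OF that] zero_le_dist[of "\<gamma> s" "\<gamma> t"] by linarith
  have "1-lipschitz_on {a..b} lam"
  proof (rule lipschitz_on_leI)
    show "dist (lam x) (lam y) \<le> 1 * dist x y" if "x \<in> {a..b}" "y \<in> {a..b}" "x \<le> y" for x y
      using up[of x y] mono[of x y] that by (auto simp: dist_real_def)
  qed simp
  then have cont: "continuous_on {a..b} lam" by (rule lipschitz_on_continuous_on)
  show img: "lam ` {a..b} = {0..lam b}"
  proof safe
    fix t assume "t \<in> {a..b}" then show "lam t \<in> {0..lam b}" using mono[of t b] nn by auto
  next
    fix s assume "s \<in> {0..lam b}"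
    then obtain t where "a \<le> t" "t \<le> b" "lam t = s"
      using IVT'[of lam a s b] 0 ab cont by auto
    then show "s \<in> lam ` {a..b}" by auto
  qed
  show par: "arclength_param \<gamma> a b (lam t) = \<gamma> t" if t: "t \<in> {a..b}" for t
  proof -
    define r where "r = (SOME r. r \<in> {a..b} \<and> curve_length \<gamma> a r = ennreal (lam t))"
    have "r \<in> {a..b} \<and> curve_length \<gamma> a r = ennreal (lam t)"
      unfolding r_def by (rule someI[of _ t]) (use t eq in auto)
    then have r: "r \<in> {a..b}" "lam r = lam t" using nn by (auto simp: eq)
    have "dist (\<gamma> r) (\<gamma> t) \<le> 0"
    proof (cases "r \<le> t")
      case True
      with lo[of r t] r t show ?thesis by simp
    next
      case False
      with lo[of t r] r t show ?thesis by (subst dist_commute) simp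
    qed
    then show ?thesis unfolding arclength_param_def r_def[symmetric] by simp
  qed
  show "1-lipschitz_on {0..lam b} (arclength_param \<gamma> a b)"
  proof (rule lipschitz_onI)
    fix x y assume "x \<in> {0..lam b}" "y \<in> {0..lam b}"
    then have "x \<in> lam ` {a..b}" "y \<in> lam ` {a..b}" by (simp_all only: img)
    then obtain s t where st: "s \<in> {a..b}" "t \<in> {a..b}" "x = lam s" "y = lam t"
      by (elim imageE)
    have "dist (\<gamma> s) (\<gamma> t) \<le> \<bar>lam s - lam t\<bar>"
    proof (cases "s \<le> t")
      case True
      with lo[of s t] st(1,2) show ?thesis by simp
    next
      case False
      with lo[of t s] st(1,2) show ?thesis by (subst dist_commute) simp
    qed
    then show "dist (arclength_param \<gamma> a b x) (arclength_param \<gamma> a b y) \<le> 1 * dist x y"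
      by (simp add: st(3,4) par[OF st(1)] par[OF st(2)] dist_real_def)
  qed simp
qed

section \<open>Comparison of the line integral with the parameter integral\<close>

text \<open>Chaining over equal subintervals shorter than \<open>\<delta>\<close> turns an estimate
  at small scale into one on the whole interval.\<close>

lemma nonneg_increment_from_small_steps:
  fixes \<phi> :: "real \<Rightarrow> real"
  assumes "\<delta> > 0" "a \<le> b"
    and step: "\<And>s t. a \<le> s \<Longrightarrow> s \<le> t \<Longrightarrow> t \<le> b \<Longrightarrow> t - s < \<delta> \<Longrightarrow> \<phi> s \<le> \<phi> t"
  shows "\<phi> a \<le> \<phi> b"
proof -
  obtain n :: nat where n: "(b - a) / \<delta> < real n" "n > 0"
  proof -
    obtain m :: nat where "(b - a) / \<delta> < real m" using reals_Archimedean2 by blast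
    then show ?thesis using that[of "Suc m"] by simp
  qed
  define t where "t k = a + (b - a) * (real k / real n)" for k
  have small: "(b - a) / n < \<delta>"
    using n \<open>\<delta> > 0\<close> by (simp add: field_simps)
  have "\<phi> a \<le> \<phi> (t k)" if "k \<le> n" for k
    using that
  proof (induction k)
    case (Suc k)
    have d: "t (Suc k) - t k = (b - a) / n"
      by (simp add: t_def add_divide_distrib algebra_simps diff_divide_distrib)
    have "real (Suc k) / n \<le> 1" using Suc.prems n by simp
    then have "t (Suc k) \<le> b"
      using mult_left_mono[of "real (Suc k) / n" 1 "b - a"] \<open>a \<le> b\<close> by (simp add: t_def)
    moreover have "a \<le> t k" using \<open>a \<le> b\<close> by (simp add: t_def)
    moreover have "0 \<le> (b - a) / n" using \<open>a \<le> b\<close> by simp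
    ultimately have "\<phi> (t k) \<le> \<phi> (t (Suc k))"
      using d small by (intro step) linarith+
    with Suc show ?case by simp
  qed (simp add: t_def)
  from this[of n] show ?thesis using n by (simp add: t_def)
qed

text \<open>Morally a change of variables with speed at most 1. Instead of differentiating
  \<open>l\<close>, the integrals are compared on short intervals where \<open>h\<close> along the
  curve varies by at most \<open>e\<close>; the errors add up to \<open>2 * e * (b - a)\<close>, and
  \<open>e\<close> is arbitrary.\<close>

lemma line_integral_lipschitz_curve_le:
  fixes \<gamma> :: "real \<Rightarrow> 'a::metric_space" and h :: "'a \<Rightarrow> real"
  assumes lip: "1-lipschitz_on {a..b} \<gamma>" and ab: "a \<le> b"
    and h: "continuous_on UNIV h" "\<And>x. 0 \<le> h x"
  shows "line_integral \<gamma> a b (\<lambda>x. ennreal (h x)) \<le> ennreal (integral {a..b} (\<lambda>t. h (\<gamma> t)))"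
proof -
  define l where "l t = enn2real (curve_length \<gamma> a t)" for t
  define \<sigma> where "\<sigma> = arclength_param \<gamma> a b"
  note arc = arclength_lipschitz_curve[OF lip ab, folded l_def \<sigma>_def]
  have mono: "l s \<le> l t" if "a \<le> s" "s \<le> t" "t \<le> b" for s t
    using arc(4)[OF that] zero_le_dist[of "\<gamma> s" "\<gamma> t"] by linarith
  have lnn: "0 \<le> l t" for t by (simp add: l_def)
  have cH: "continuous_on {0..l b} (\<lambda>s. h (\<sigma> s))"
    by (rule continuous_on_compose2[OF h(1) lipschitz_on_continuous_on[OF arc(7)]]) simp
  have cK: "continuous_on {a..b} (\<lambda>t. h (\<gamma> t))"
    by (rule continuous_on_compose2[OF h(1) lipschitz_on_continuous_on[OF lip]]) simp
  have iH: "(\<lambda>s. h (\<sigma> s)) integrable_on {u..v}" if "0 \<le> u" "v \<le> l b" for u v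
    by (rule integrable_continuous_interval, rule continuous_on_subset[OF cH]) (use that in auto)
  have iK: "(\<lambda>s. h (\<gamma> s)) integrable_on {u..v}" if "a \<le> u" "v \<le> b" for u v
    by (rule integrable_continuous_interval, rule continuous_on_subset[OF cK]) (use that in auto)
  have eps: "integral {0..l b} (\<lambda>s. h (\<sigma> s)) \<le> integral {a..b} (\<lambda>t. h (\<gamma> t)) + 2 * e * (b - a)"
    if "e > 0" for e
  proof -
    have "uniformly_continuous_on {a..b} (\<lambda>t. h (\<gamma> t))"
      by (rule compact_uniformly_continuous[OF cK]) simp
    then obtain \<delta> where \<delta>: "\<delta> > 0" 
      "\<And>s t. s \<in> {a..b} \<Longrightarrow> t \<in> {a..b} \<Longrightarrow> dist t s < \<delta> \<Longrightarrow> dist (h (\<gamma> t)) (h (\<gamma> s)) < e"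
      using \<open>e > 0\<close> unfolding uniformly_continuous_on_def by metis
    \<comment> \<open>The slack of the desired inequality up to time \<open>t\<close>, error term
      included. It vanishes at \<open>a\<close> and does not decrease over steps shorter than
      \<open>\<delta>\<close>.\<close>
    define \<phi> where "\<phi> t = integral {a..t} (\<lambda>t. h (\<gamma> t)) + 2 * e * (t - a) - integral {0..l t} (\<lambda>s. h (\<sigma> s))" for t
    have "\<phi> a \<le> \<phi> b"
    proof (rule nonneg_increment_from_small_steps[OF \<delta>(1) ab])
      fix s t assume st: "a \<le> s" "s \<le> t" "t \<le> b" "t - s < \<delta>"
      have close: "\<bar>h (\<gamma> r) - h (\<gamma> s)\<bar> \<le> e" if "s \<le> r" "r \<le> t" for r
        using \<delta>(2)[of s r] st that by (auto simp: dist_real_def)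
      have "integral {l s..l t} (\<lambda>s. h (\<sigma> s)) \<le> integral {l s..l t} (\<lambda>_. h (\<gamma> s) + e)"
      proof (rule integral_le)
        show "(\<lambda>s. h (\<sigma> s)) integrable_on {l s..l t}"
          using iH lnn mono st by auto
        fix x assume x: "x \<in> {l s..l t}"
        then have "x \<in> l ` {a..b}" unfolding arc(5) using lnn[of s] mono[of t b] st by auto
        then obtain r where r: "r \<in> {a..b}" "x = l r" by auto
        \<comment> \<open>If \<open>r\<close> lies outside \<open>[s,t]\<close>, monotonicity makes
          \<open>l\<close> constant between \<open>r\<close> and the nearer endpoint, so clamping
          keeps the value \<open>x\<close>.\<close>
        define r' where "r' = max s (min r t)"
        have r': "s \<le> r'" "r' \<le> t" "x = l r'"
          using r x st mono[of r s] mono[of t r] by (auto simp: r'_def max_def min_def)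
        then show "h (\<sigma> x) \<le> h (\<gamma> s) + e"
          using close[of r'] arc(6)[of r'] st by auto
      qed (rule integrable_const_ivl)
      also have "\<dots> = (l t - l s) * (h (\<gamma> s) + e)"
        using mono st by simp
      \<comment> \<open>Here length grows no faster than the parameter, and the second factor is
        nonnegative. Replacing \<open>+ e\<close> by \<open>- e\<close> next costs
        \<open>2 * e * (t - s)\<close>.\<close>
      also have "\<dots> \<le> (t - s) * (h (\<gamma> s) + e)"
        using arc(3)[of s t] st h(2)[of "\<gamma> s"] \<open>e > 0\<close> by (intro mult_right_mono) auto
      also have "\<dots> = integral {s..t} (\<lambda>_. h (\<gamma> s) - e) + 2 * e * (t - s)"
        using st by (simp add: algebra_simps)
      also have "integral {s..t} (\<lambda>_. h (\<gamma> s) - e) \<le> integral {s..t} (\<lambda>r. h (\<gamma> r))"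
        by (rule integral_le) (use iK st close in \<open>force simp: abs_le_iff\<close>)+
      finally have 1: "integral {l s..l t} (\<lambda>s. h (\<sigma> s)) \<le> integral {s..t} (\<lambda>r. h (\<gamma> r)) + 2 * e * (t - s)"
        by simp
      have 2: "integral {a..s} (\<lambda>t. h (\<gamma> t)) + integral {s..t} (\<lambda>t. h (\<gamma> t)) = integral {a..t} (\<lambda>t. h (\<gamma> t))"
        by (rule Henstock_Kurzweil_Integration.integral_combine) (use st iK in auto)
      have 3: "integral {0..l s} (\<lambda>t. h (\<sigma> t)) + integral {l s..l t} (\<lambda>t. h (\<sigma> t)) = integral {0..l t} (\<lambda>t. h (\<sigma> t))"
        by (rule Henstock_Kurzweil_Integration.integral_combine) (use st iH mono lnn in auto)
      show "\<phi> s \<le> \<phi> t"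
        using 1 2 3 by (simp add: \<phi>_def algebra_simps)
    qed
    then show ?thesis by (simp add: \<phi>_def arc(2))
  qed
  have le: "integral {0..l b} (\<lambda>s. h (\<sigma> s)) \<le> integral {a..b} (\<lambda>t. h (\<gamma> t))"
  proof (rule field_le_epsilon)
    fix e :: real assume "e > 0"
    \<comment> \<open>The summand 1 keeps the denominator below positive when
      \<open>a = b\<close>.\<close>
    have p: "b - a + 1 > 0" using ab by simp
    have "2 * (e / (2 * (b - a + 1))) * (b - a) \<le> e"
      using p ab \<open>e > 0\<close> by (simp add: field_simps)
    then show "integral {0..l b} (\<lambda>s. h (\<sigma> s)) \<le> integral {a..b} (\<lambda>t. h (\<gamma> t)) + e"
      using eps[of "e / (2 * (b - a + 1))"] p \<open>e > 0\<close> by simp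
  qed
  have "line_integral \<gamma> a b (\<lambda>x. ennreal (h x)) = ennreal (integral {0..l b} (\<lambda>s. h (\<sigma> s)))"
    unfolding line_integral_def l_def[symmetric] \<sigma>_def[symmetric]
    by (rule nn_integral_has_integral_lebesgue') (use h iH in auto)
  then show ?thesis using le by (simp add: ennreal_leI)
qed

text \<open>Monotone convergence in the arc length parameter; each integrand is measurable because
  \<open>gs j\<close> is continuous along the parametrization.\<close>

lemma line_integral_increasing_limit:
  fixes \<gamma> :: "real \<Rightarrow> 'a::metric_space" and g :: "'a \<Rightarrow> real" and gs :: "nat \<Rightarrow> 'a \<Rightarrow> real"
  assumes lip: "1-lipschitz_on {a..b} \<gamma>" and ab: "a \<le> b"
    and gs: "\<And>j. continuous_on UNIV (gs j)" "\<And>j x. gs j x \<le> gs (Suc j) x"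
    and lim: "\<And>x. (\<lambda>j. gs j x) \<longlonglongrightarrow> g x"
  shows "line_integral \<gamma> a b (\<lambda>x. ennreal (g x)) = (SUP j. line_integral \<gamma> a b (\<lambda>x. ennreal (gs j x)))"
proof -
  define l where "l = enn2real (curve_length \<gamma> a b)"
  define \<sigma> where "\<sigma> = arclength_param \<gamma> a b"
  note arc = arclength_lipschitz_curve(7)[OF lip ab, folded l_def \<sigma>_def]
  have inc: "incseq (\<lambda>j. gs j x)" for x using gs(2) by (rule incseq_SucI)
  have sup: "ennreal (g x) = (SUP j. ennreal (gs j x))" for x
  proof (rule LIMSEQ_unique)
    show "(\<lambda>j. ennreal (gs j x)) \<longlonglongrightarrow> ennreal (g x)" by (intro tendsto_ennrealI lim)
    show "(\<lambda>j. ennreal (gs j x)) \<longlonglongrightarrow> (SUP j. ennreal (gs j x))"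
      by (rule LIMSEQ_SUP) (use inc in \<open>auto simp: incseq_def intro: ennreal_leI\<close>)
  qed
  have "line_integral \<gamma> a b (\<lambda>x. ennreal (g x))
      = (\<integral>\<^sup>+ s. (SUP j. ennreal (gs j (\<sigma> s)) * indicator {0..l} s) \<partial>lborel)"
    unfolding line_integral_def l_def[symmetric] \<sigma>_def[symmetric] sup
    by (intro nn_integral_cong) (auto simp: indicator_def)
  also have "\<dots> = (SUP j. \<integral>\<^sup>+ s. ennreal (gs j (\<sigma> s)) * indicator {0..l} s \<partial>lborel)"
  proof (rule nn_integral_monotone_convergence_SUP)
    show "incseq (\<lambda>j s. ennreal (gs j (\<sigma> s)) * indicator {0..l} s)"
      using inc by (auto simp: incseq_def le_fun_def indicator_def intro: ennreal_leI)
    fix j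
    have "continuous_on {0..l} (\<lambda>s. gs j (\<sigma> s))"
      by (rule continuous_on_compose2[OF gs(1) lipschitz_on_continuous_on[OF arc]]) simp
    then have "(\<lambda>s. indicator {0..l} s *\<^sub>R gs j (\<sigma> s)) \<in> borel_measurable borel"
      by (intro borel_measurable_continuous_on_indicator) auto
    then have "(\<lambda>s. ennreal (indicator {0..l} s *\<^sub>R gs j (\<sigma> s))) \<in> borel_measurable lborel"
      by simp
    also have "(\<lambda>s. ennreal (indicator {0..l} s *\<^sub>R gs j (\<sigma> s))) = (\<lambda>s. ennreal (gs j (\<sigma> s)) * indicator {0..l} s)"
      by (auto simp: indicator_def fun_eq_iff)
    finally show "(\<lambda>s. ennreal (gs j (\<sigma> s)) * indicator {0..l} s) \<in> borel_measurable lborel" .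
  qed
  finally show ?thesis
    unfolding line_integral_def l_def[symmetric] \<sigma>_def[symmetric] .
qed

section \<open>Compactness of 1-Lipschitz curves with a common starting point\<close>

text \<open>A first subsequence \<open>p\<close> makes the stopping times converge. The curves are
  then compared on the common interval \<open>{0..M}\<close>, where the shared start and the
  Lipschitz bound give the boundedness and equicontinuity for Arzela-Ascoli, which yields
  \<open>q\<close>.\<close>

lemma lipschitz_curves_subsequence:
  fixes \<gamma> :: "nat \<Rightarrow> real \<Rightarrow> 'a::{real_normed_vector,heine_borel}"
  assumes lip: "\<And>i. 1-lipschitz_on UNIV (\<gamma> i)" and start: "\<And>i. \<gamma> i 0 = x"
    and T: "\<And>i. 0 \<le> T i" "\<And>i. T i \<le> M"
  obtains r \<gamma>' T' where "strict_mono (r :: nat \<Rightarrow> nat)" "1-lipschitz_on {0..M} \<gamma>'" "\<gamma>' 0 = x"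
    "0 \<le> T'" "T' \<le> M" "(\<lambda>i. T (r i)) \<longlonglongrightarrow> T'"
    "\<And>s. s \<in> {0..M} \<Longrightarrow> (\<lambda>i. \<gamma> (r i) s) \<longlonglongrightarrow> \<gamma>' s"
proof -
  have M: "0 \<le> M" using T[of 0] by simp
  have "\<exists>l\<in>{0..M}. \<exists>p. strict_mono (p :: nat \<Rightarrow> nat) \<and> (T \<circ> p) \<longlonglongrightarrow> l"
    using T by (intro compact_imp_seq_compact[OF compact_Icc, unfolded seq_compact_def, rule_format]) auto
  then obtain T' p where p: "T' \<in> {0..M}" "strict_mono (p :: nat \<Rightarrow> nat)" "(T \<circ> p) \<longlonglongrightarrow> T'"
    by blast
  have bound: "norm (\<gamma> (p n) s) \<le> norm x + M" if "s \<in> {0..M}" for n s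
    using lipschitz_onD[OF lip[of "p n"], of s 0] start[of "p n"] that norm_triangle_sub[of "\<gamma> (p n) s" x]
    by (auto simp: dist_norm)
  have equi: "\<exists>d. 0 < d \<and> (\<forall>n t. t \<in> {0..M} \<and> norm (s - t) < d \<longrightarrow> norm (\<gamma> (p n) s - \<gamma> (p n) t) < e)"
    if "e > 0" for s e
  proof (intro exI[of _ e] conjI allI impI)
    fix n t assume "t \<in> {0..M} \<and> norm (s - t) < e"
    then show "norm (\<gamma> (p n) s - \<gamma> (p n) t) < e"
      using lipschitz_onD[OF lip[of "p n"], of s t] by (simp add: dist_norm)
  qed (rule that)
  obtain \<gamma>' q where q: "strict_mono (q :: nat \<Rightarrow> nat)"
    "\<And>e. 0 < e \<Longrightarrow> \<exists>N. \<forall>n s. n \<ge> N \<and> s \<in> {0..M} \<longrightarrow> norm (\<gamma> (p (q n)) s - \<gamma>' s) < e"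
    using Arzela_Ascoli[of "{0..M}" "\<lambda>n. \<gamma> (p n)" "norm x + M"] bound equi by (metis compact_Icc)
  define r where "r = p \<circ> q"
  have r: "strict_mono r" unfolding r_def using p q by (intro strict_mono_o)
  have conv: "(\<lambda>i. \<gamma> (r i) s) \<longlonglongrightarrow> \<gamma>' s" if "s \<in> {0..M}" for s
    unfolding LIMSEQ_def using q(2) that by (simp add: r_def dist_norm) meson
  have "1-lipschitz_on {0..M} \<gamma>'"
  proof (rule lipschitz_onI)
    fix s t assume st: "s \<in> {0..M}" "t \<in> {0..M}"
    have "(\<lambda>i. dist (\<gamma> (r i) s) (\<gamma> (r i) t)) \<longlonglongrightarrow> dist (\<gamma>' s) (\<gamma>' t)"
      by (intro tendsto_dist conv st)
    then show "dist (\<gamma>' s) (\<gamma>' t) \<le> 1 * dist s t"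
      by (rule LIMSEQ_le_const2) (use lipschitz_onD[OF lip] in auto)
  qed simp
  moreover have "\<gamma>' 0 = x"
    using conv[of 0] M by (simp add: start LIMSEQ_const_iff)
  moreover have "(\<lambda>i. T (r i)) \<longlonglongrightarrow> T'"
    using LIMSEQ_subseq_LIMSEQ[OF p(3) q(1)] by (simp add: r_def o_def)
  ultimately show thesis using that r conv p(1) by auto
qed

section \<open>The infimal cost of curves\<close>

text \<open>Speed at most 1, rather than exactly 1, is stable under limits of curves. Curves live on
  the whole line so that curves with different stopping times share a domain; only
  \<open>[0,T]\<close> enters the cost.\<close>

definition curve_costs :: "('a::real_normed_vector \<Rightarrow> real) \<Rightarrow> ('a \<Rightarrow> real) \<Rightarrow> 'a \<Rightarrow> real set" where
  "curve_costs f h x = {f (\<gamma> T) + integral {0..T} (\<lambda>s. h (\<gamma> s)) | (\<gamma> :: real \<Rightarrow> 'a) T.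
     0 \<le> T \<and> 1-lipschitz_on UNIV \<gamma> \<and> \<gamma> 0 = x}"

text \<open>The value function of a control problem with running cost \<open>h\<close> and terminal
  cost \<open>f\<close> paid at a freely chosen time. Heuristically it is the largest function below
  \<open>f\<close> whose gradient is bounded by \<open>h\<close>.\<close>

definition eikonal_envelope :: "('a::real_normed_vector \<Rightarrow> real) \<Rightarrow> ('a \<Rightarrow> real) \<Rightarrow> 'a \<Rightarrow> real" where
  "eikonal_envelope f h x = Inf (curve_costs f h x)"

text \<open>Stopping at time 0 costs \<open>f x\<close>. This makes the cost set nonempty and puts
  the envelope below \<open>f\<close>.\<close>

lemma self_in_curve_costs: "f x \<in> curve_costs f h x"
  unfolding curve_costs_def
  by (rule CollectI, rule exI[of _ "\<lambda>_. x"], rule exI[of _ 0]) (auto intro: lipschitz_onI)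

text \<open>The same \<open>L\<close> bounds the slope of \<open>f\<close> and is the price of
  travel outside the ball, so travelling there never pays off.\<close>

locale eikonal =
  fixes f h :: "'a::{real_normed_vector,heine_borel} \<Rightarrow> real" and L R :: real
  assumes f_lip: "L-lipschitz_on UNIV f"
    and h_cont: "continuous_on UNIV h"
    and h_nonneg: "\<And>x. 0 \<le> h x"
    and h_le: "\<And>x. h x \<le> L"
    and h_outside: "\<And>x. x \<notin> ball 0 R \<Longrightarrow> h x = L"
begin

lemma continuous_on_h_curve: "1-lipschitz_on S \<gamma> \<Longrightarrow> continuous_on S (\<lambda>s. h (\<gamma> s))"
  by (rule continuous_on_compose2[OF h_cont lipschitz_on_continuous_on]) auto

lemma integrable_h_curve: "1-lipschitz_on UNIV \<gamma> \<Longrightarrow> (\<lambda>s. h (\<gamma> s)) integrable_on {a..b::real}"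
  by (intro integrable_continuous_interval continuous_on_h_curve) (auto intro: lipschitz_on_subset)

text \<open>Per unit of parameter the curve pays \<open>L\<close>, while \<open>f\<close> drops by
  at most \<open>L\<close>.\<close>

lemma cost_outside_ball:
  fixes a b :: real
  assumes \<gamma>: "1-lipschitz_on UNIV \<gamma>" and "a \<le> b"
    and out: "\<And>t. a < t \<Longrightarrow> t \<le> b \<Longrightarrow> \<gamma> t \<notin> ball 0 R"
  shows "f (\<gamma> a) \<le> f (\<gamma> b) + integral {a..b} (\<lambda>s. h (\<gamma> s))"
proof -
  have "integral {a..b} (\<lambda>s. h (\<gamma> s)) = integral {a..b} (\<lambda>s. L)"
  \<comment> \<open>At time \<open>a\<close> the curve may still be in the ball, as it is at a last
    exit time; a single point does not affect the integral.\<close>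
  proof (rule integral_spike[of "{a}"])
    fix t assume "t \<in> {a..b} - {a}"
    then show "L = h (\<gamma> t)" using h_outside[OF out[of t]] by simp
  qed simp
  also have "\<dots> = L * (b - a)" using \<open>a \<le> b\<close> by simp
  finally have I: "integral {a..b} (\<lambda>s. h (\<gamma> s)) = L * (b - a)" .
  have "f (\<gamma> a) - f (\<gamma> b) \<le> L * dist (\<gamma> a) (\<gamma> b)"
    using lipschitz_onD[OF f_lip, of "\<gamma> a" "\<gamma> b"] by (simp add: dist_real_def)
  also have "\<dots> \<le> L * (b - a)"
    using lipschitz_onD[OF \<gamma>, of a b] \<open>a \<le> b\<close> lipschitz_on_nonneg[OF f_lip]
    by (intro mult_left_mono) (auto simp: dist_real_def)
  finally show ?thesis using I by simp
qed

text \<open>Stopping at the last visit to the closed ball, or at time 0 if there is none, does not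
  raise the cost. Endpoints thereby lie in a compact set or at the start.\<close>

lemma cost_last_exit:
  fixes T :: real
  assumes \<gamma>: "1-lipschitz_on UNIV \<gamma>" and "0 \<le> T"
  shows "f (\<gamma> 0) \<le> f (\<gamma> T) + integral {0..T} (\<lambda>s. h (\<gamma> s)) \<or>
    (\<exists>\<tau>\<ge>0. \<gamma> \<tau> \<in> cball 0 R \<and>
      f (\<gamma> \<tau>) + integral {0..\<tau>} (\<lambda>s. h (\<gamma> s)) \<le> f (\<gamma> T) + integral {0..T} (\<lambda>s. h (\<gamma> s)))"
proof (cases "\<exists>t\<in>{0..T}. \<gamma> t \<in> cball 0 R")
  case False
  then have "\<gamma> t \<notin> ball 0 R" if "0 < t" "t \<le> T" for t
    using that by (meson atLeastAtMost_iff ball_subset_cball less_imp_le subsetD)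
  then have "f (\<gamma> 0) \<le> f (\<gamma> T) + integral {0..T} (\<lambda>s. h (\<gamma> s))"
    by (rule cost_outside_ball[OF \<gamma> \<open>0 \<le> T\<close>])
  then show ?thesis ..
next
  case True
  define A where "A = {0..T} \<inter> \<gamma> -` cball 0 R"
  have "compact A" unfolding A_def
    using lipschitz_on_continuous_on[OF \<gamma>]
    by (intro compact_Int_closed continuous_closed_vimage)
      (auto simp: continuous_on_eq_continuous_at)
  moreover have "A \<noteq> {}" using True by (auto simp: A_def)
  ultimately obtain \<tau> where \<tau>: "\<tau> \<in> A" "\<And>t. t \<in> A \<Longrightarrow> t \<le> \<tau>"
    by (meson compact_attains_sup)
  then have \<tau>': "0 \<le> \<tau>" "\<tau> \<le> T" "\<gamma> \<tau> \<in> cball 0 R" by (auto simp: A_def)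
  have "f (\<gamma> \<tau>) \<le> f (\<gamma> T) + integral {\<tau>..T} (\<lambda>s. h (\<gamma> s))"
  proof (rule cost_outside_ball[OF \<gamma> \<tau>'(2)])
    fix t assume "\<tau> < t" "t \<le> T"
    then have "t \<notin> A" using \<tau>(2)[of t] by auto
    then show "\<gamma> t \<notin> ball 0 R" using \<open>\<tau> < t\<close> \<open>t \<le> T\<close> \<tau>'(1) by (auto simp: A_def)
  qed
  moreover have "integral {0..\<tau>} (\<lambda>s. h (\<gamma> s)) + integral {\<tau>..T} (\<lambda>s. h (\<gamma> s)) = integral {0..T} (\<lambda>s. h (\<gamma> s))"
    by (rule Henstock_Kurzweil_Integration.integral_combine[OF \<tau>'(1,2) integrable_h_curve[OF \<gamma>]])
  ultimately show ?thesis using \<tau>' by (intro disjI2 exI[of _ \<tau>]) auto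
qed

text \<open>The case split covers negative \<open>R\<close>, for which the ball is empty.\<close>

lemma f_bounded_below_cball: obtains m where "\<And>x. x \<in> cball 0 R \<Longrightarrow> m \<le> f x"
proof (cases "cball (0::'a) R = {}")
  case False
  have "continuous_on (cball 0 R) f"
    using lipschitz_on_continuous_on[OF f_lip] by (rule continuous_on_subset) simp
  then show thesis
    using continuous_attains_inf[of "cball 0 R" f] False that by (metis compact_cball)
qed (use that in auto)

text \<open>After stopping at the last exit, a cost is at least \<open>f x\<close> or at least the
  minimum of \<open>f\<close> on the ball, as the integral is nonnegative. So \<open>Inf\<close> is
  a genuine infimum.\<close>

lemma bdd_below_curve_costs: "bdd_below (curve_costs f h x)"
proof -
  obtain m where m: "\<And>y. y \<in> cball 0 R \<Longrightarrow> m \<le> f y" using f_bounded_below_cball by blast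
  show ?thesis
  proof (rule bdd_belowI)
    fix c assume "c \<in> curve_costs f h x"
    then obtain \<gamma> and T :: real where \<gamma>: "0 \<le> T" "1-lipschitz_on UNIV \<gamma>" "\<gamma> 0 = x"
      and c: "c = f (\<gamma> T) + integral {0..T} (\<lambda>s. h (\<gamma> s))"
      unfolding curve_costs_def by blast
    from cost_last_exit[OF \<gamma>(2,1)] show "min m (f x) \<le> c"
    proof (elim disjE exE conjE)
      fix \<tau> assume \<tau>: "\<gamma> \<tau> \<in> cball 0 R"
        "f (\<gamma> \<tau>) + integral {0..\<tau>} (\<lambda>s. h (\<gamma> s)) \<le> f (\<gamma> T) + integral {0..T} (\<lambda>s. h (\<gamma> s))"
      have "0 \<le> integral {0..\<tau>} (\<lambda>s. h (\<gamma> s))"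
        by (rule integral_nonneg[OF integrable_h_curve[OF \<gamma>(2)]]) (simp add: h_nonneg)
      with m[OF \<tau>(1)] \<tau>(2) show ?thesis by (simp add: c)
    qed (simp add: c \<gamma>(3))
  qed
qed

lemma eikonal_envelope_le: "eikonal_envelope f h x \<le> f x"
  unfolding eikonal_envelope_def
  by (rule cInf_lower[OF self_in_curve_costs bdd_below_curve_costs])

section \<open>Lipschitz bounds for the envelope\<close>

lemma eikonal_envelope_segment:
  assumes K: "\<And>z. z \<in> closed_segment u v \<Longrightarrow> h z \<le> K"
  shows "eikonal_envelope f h u \<le> eikonal_envelope f h v + K * dist u v"
proof (cases "u = v")
  case False
  define d where "d = dist u v"
  have d: "d > 0" using False by (simp add: d_def)
  have "eikonal_envelope f h u - K * d \<le> Inf (curve_costs f h v)"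
  proof (rule cInf_greatest)
    show "curve_costs f h v \<noteq> {}" using self_in_curve_costs by blast
    fix c assume "c \<in> curve_costs f h v"
    then obtain \<gamma> and T :: real where \<gamma>: "0 \<le> T" "1-lipschitz_on UNIV \<gamma>" "\<gamma> 0 = v"
      and c: "c = f (\<gamma> T) + integral {0..T} (\<lambda>s. h (\<gamma> s))"
      unfolding curve_costs_def by blast
    \<comment> \<open>\<open>\<alpha>\<close> runs from \<open>u\<close> to \<open>v\<close> at unit
      speed in time \<open>d\<close>, and \<open>\<beta>\<close> then follows
      \<open>\<gamma>\<close>. For negative times \<open>\<beta>\<close> stays on the line, which
      keeps it 1-Lipschitz on all reals.\<close>
    define \<alpha> where "\<alpha> s = u + (s / d) *\<^sub>R (v - u)" for s
    define \<beta> where "\<beta> s = (if s \<le> d then \<alpha> s else \<gamma> (s - d))" for s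
    have \<alpha>: "dist (\<alpha> s) (\<alpha> t) = \<bar>s - t\<bar>" for s t
    proof -
      have "\<alpha> s - \<alpha> t = ((s - t) / d) *\<^sub>R (v - u)"
        by (simp add: \<alpha>_def scaleR_left_diff_distrib[symmetric] diff_divide_distrib)
      then show ?thesis using d by (simp add: dist_norm d_def norm_minus_commute)
    qed
    have \<alpha>d: "\<alpha> d = v" using d by (simp add: \<alpha>_def)
    have \<gamma>D: "dist (\<gamma> s) (\<gamma> t) \<le> \<bar>s - t\<bar>" for s t
      using lipschitz_onD[OF \<gamma>(2), of s t] by (simp add: dist_real_def)
    have \<beta>: "1-lipschitz_on UNIV \<beta>"
    proof (rule lipschitz_on_leI)
      fix s t :: real assume "s \<le> t"
      consider "t \<le> d" | "d < s" | "s \<le> d" "d < t" using \<open>s \<le> t\<close> by linarith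
      then show "dist (\<beta> s) (\<beta> t) \<le> 1 * dist s t"
      proof cases
        case 3
        then show ?thesis
          using dist_triangle[of "\<alpha> s" "\<gamma> (t - d)" v] \<alpha>[of s d] \<gamma>D[of 0 "t - d"]
          by (simp add: \<beta>_def \<alpha>d \<gamma>(3) dist_real_def)
      qed (use \<open>s \<le> t\<close> \<alpha> \<gamma>D[of "s - d" "t - d"] in \<open>auto simp: \<beta>_def dist_real_def\<close>)
    qed simp
    have "f (\<beta> (T + d)) + integral {0..T + d} (\<lambda>s. h (\<beta> s)) \<in> curve_costs f h u"
      unfolding curve_costs_def using \<beta> \<gamma>(1) d
      by (intro CollectI exI[of _ \<beta>] exI[of _ "T + d"]) (auto simp: \<beta>_def \<alpha>_def)
    then have "eikonal_envelope f h u \<le> f (\<beta> (T + d)) + integral {0..T + d} (\<lambda>s. h (\<beta> s))"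
      unfolding eikonal_envelope_def by (rule cInf_lower[OF _ bdd_below_curve_costs])
    also have "integral {0..T + d} (\<lambda>s. h (\<beta> s))
        = integral {0..d} (\<lambda>s. h (\<beta> s)) + integral {d..T + d} (\<lambda>s. h (\<beta> s))"
      by (rule Henstock_Kurzweil_Integration.integral_combine[symmetric, OF _ _ integrable_h_curve[OF \<beta>]])
        (use d \<gamma>(1) in auto)
    also have "integral {0..d} (\<lambda>s. h (\<beta> s)) \<le> integral {0..d} (\<lambda>s. K)"
    proof (rule integral_le[OF integrable_h_curve[OF \<beta>] integrable_const_ivl])
      fix s assume s: "s \<in> {0..d}"
      have "\<alpha> s = (1 - s / d) *\<^sub>R u + (s / d) *\<^sub>R v"
        by (simp add: \<alpha>_def algebra_simps)
      then have "\<alpha> s \<in> closed_segment u v"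
        unfolding closed_segment_def using s d by (intro CollectI exI[of _ "s / d"]) auto
      then show "h (\<beta> s) \<le> K" using K s by (simp add: \<beta>_def)
    qed
    also have "integral {d..T + d} (\<lambda>s. h (\<beta> s)) = integral {0..T} ((\<lambda>s. h (\<beta> s)) \<circ> (+) d)"
      by (simp add: integral_shift_Icc_real)
    \<comment> \<open>At \<open>s = 0\<close> the value \<open>\<beta> d\<close> comes from the
      segment branch, and \<open>\<alpha> d = v = \<gamma> 0\<close>.\<close>
    also have "\<dots> = integral {0..T} (\<lambda>s. h (\<gamma> s))"
      by (rule integral_cong) (auto simp: \<beta>_def \<alpha>d \<gamma>(3))
    also have "f (\<beta> (T + d)) = f (\<gamma> T)"
      using \<gamma>(1,3) by (auto simp: \<beta>_def \<alpha>d)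
    finally show "eikonal_envelope f h u - K * d \<le> c"
      using d by (simp add: c algebra_simps)
  qed
  then show ?thesis by (simp add: eikonal_envelope_def d_def)
qed simp

lemma eikonal_envelope_lipschitz_on:
  assumes "convex S" "0 \<le> K" and K: "\<And>z. z \<in> S \<Longrightarrow> h z \<le> K"
  shows "K-lipschitz_on S (eikonal_envelope f h)"
proof (rule lipschitz_onI[OF _ \<open>0 \<le> K\<close>])
  fix u v assume "u \<in> S" "v \<in> S"
  then have "closed_segment u v \<subseteq> S" "closed_segment v u \<subseteq> S"
    using \<open>convex S\<close> by (simp_all add: closed_segment_subset)
  then show "dist (eikonal_envelope f h u) (eikonal_envelope f h v) \<le> K * dist u v"
    using eikonal_envelope_segment[of u v K] eikonal_envelope_segment[of v u K] K
    by (auto simp: dist_real_def dist_commute subset_iff abs_le_iff)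
qed

text \<open>By continuity \<open>h \<le> h x + e\<close> on small balls around \<open>x\<close>;
  these are convex, so the envelope is \<open>(h x + e)\<close>-Lipschitz there.\<close>

lemma Lip_a_eikonal_envelope_le: "Lip_a (eikonal_envelope f h) x \<le> ennreal (h x)"
proof (rule ennreal_le_epsilon)
  fix e :: real assume "e > 0"
  have "isCont h x" using h_cont by (simp add: continuous_on_eq_continuous_at)
  then obtain r where r: "r > 0" "\<And>z. dist z x < r \<Longrightarrow> dist (h z) (h x) < e"
    using \<open>e > 0\<close> unfolding continuous_at_eps_delta by blast
  have "LIP (ball x s) (eikonal_envelope f h) \<le> ennreal (h x + e)" if "s < r" for s
  proof (subst lipschitz_on_iff_LIP_le[symmetric])
    show "0 \<le> h x + e" using h_nonneg[of x] \<open>e > 0\<close> by simp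
    then show "(h x + e)-lipschitz_on (ball x s) (eikonal_envelope f h)"
    proof (intro eikonal_envelope_lipschitz_on convex_ball)
      fix z assume "z \<in> ball x s"
      then show "h z \<le> h x + e"
        using r(2)[of z] that by (auto simp: dist_commute dist_real_def)
    qed
  qed
  then have "\<forall>\<^sub>F s in at_right 0. LIP (ball x s) (eikonal_envelope f h) \<le> ennreal (h x + e)"
    using r(1) by (auto simp: eventually_at_right_field)
  then have "Lip_a (eikonal_envelope f h) x \<le> ennreal (h x + e)"
    by (intro tendsto_upperbound[OF tendsto_Lip_a]) auto
  then show "Lip_a (eikonal_envelope f h) x \<le> ennreal (h x) + ennreal e"
    using h_nonneg[of x] \<open>e > 0\<close> by simp
qed

end

section \<open>Convergence of the envelopes\<close>

text \<open>A Dini-type argument: the open sets where \<open>gs i\<close> is positive cover the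
  closed ball, so by compactness and monotonicity one index serves the whole ball, and the minimum
  there is positive. Outside, the value is \<open>L\<close>.\<close>

lemma increasing_eventually_bounded_away:
  fixes gs :: "nat \<Rightarrow> 'a::{real_normed_vector,heine_borel} \<Rightarrow> real"
  assumes cont: "\<And>i. continuous_on UNIV (gs i)"
    and mono: "\<And>i x. gs i x \<le> gs (Suc i) x"
    and lim: "\<And>x. (\<lambda>i. gs i x) \<longlonglongrightarrow> g x" and pos: "\<And>x. 0 < g x"
    and out: "\<And>i x. x \<notin> ball 0 R \<Longrightarrow> gs i x = L" and "L > 0"
  obtains c i0 where "c > 0" "\<And>i x. i \<ge> i0 \<Longrightarrow> c \<le> gs i x"
proof -
  have inc: "gs i x \<le> gs j x" if "i \<le> j" for i j x
    using lift_Suc_mono_le[of "\<lambda>i. gs i x"] mono that by blast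
  define U where "U i = {x. 0 < gs i x}" for i
  have "open (U i)" for i
    unfolding U_def by (intro open_Collect_less cont continuous_intros)
  moreover have "cball 0 R \<subseteq> (\<Union>i. U i)"
  proof
    fix x
    have "\<forall>\<^sub>F i in sequentially. 0 < gs i x" using order_tendstoD(1)[OF lim pos] .
    then show "x \<in> (\<Union>i. U i)" by (auto simp: U_def eventually_sequentially)
  qed
  ultimately obtain I where I: "finite I" "cball 0 R \<subseteq> (\<Union>i\<in>I. U i)"
    using compactE_image[OF compact_cball, of UNIV U "0::'a" R] by metis
  \<comment> \<open>The inserted 0 makes \<open>Max\<close> meaningful when \<open>I\<close> is
    empty.\<close>
  define i0 where "i0 = Max (insert 0 I)"
  have pos0: "0 < gs i0 x" for x
  proof (cases "x \<in> ball 0 R")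
    case True
    then obtain i where i: "i \<in> I" "0 < gs i x" using I by (force simp: U_def)
    moreover have "i \<le> i0" unfolding i0_def using I(1) i(1) by (intro Max_ge) auto
    ultimately show ?thesis using inc[of i i0 x] by linarith
  qed (use out \<open>L > 0\<close> in simp)
  have "\<exists>c>0. \<forall>x. c \<le> gs i0 x"
  proof (cases "cball (0::'a) R = {}")
    case True
    then have "ball (0::'a) R = {}" by auto
    then have "gs i0 x = L" for x using out[of x i0] by blast
    then show ?thesis using \<open>L > 0\<close> by (intro exI[of _ L]) simp
  next
    case False
    obtain z where z: "\<And>x. x \<in> cball 0 R \<Longrightarrow> gs i0 z \<le> gs i0 x"
      using continuous_attains_inf[OF compact_cball False continuous_on_subset[OF cont]] by blast
    have "min L (gs i0 z) \<le> gs i0 x" for x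
      using z[of x] out[of x i0] by (cases "x \<in> ball 0 R") auto
    then show ?thesis using pos0 \<open>L > 0\<close> by (intro exI[of _ "min L (gs i0 z)"]) auto
  qed
  then obtain c where c: "c > 0" "\<And>x. c \<le> gs i0 x" by blast
  then show thesis using that[of c i0] inc order_trans by blast
qed

lemma eikonal_envelope_mono:
  assumes h: "eikonal f h L R" and k: "eikonal f k L R" and le: "\<And>x. h x \<le> k x"
  shows "eikonal_envelope f h x \<le> eikonal_envelope f k x"
  unfolding eikonal_envelope_def[of f k]
proof (rule cInf_greatest)
  show "curve_costs f k x \<noteq> {}" using self_in_curve_costs by blast
  fix c assume "c \<in> curve_costs f k x"
  then obtain \<gamma> and T :: real where \<gamma>: "0 \<le> T" "1-lipschitz_on UNIV \<gamma>" "\<gamma> 0 = x"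
    and c: "c = f (\<gamma> T) + integral {0..T} (\<lambda>s. k (\<gamma> s))"
    unfolding curve_costs_def by blast
  have "eikonal_envelope f h x \<le> f (\<gamma> T) + integral {0..T} (\<lambda>s. h (\<gamma> s))"
    unfolding eikonal_envelope_def using \<gamma>
    by (intro cInf_lower eikonal.bdd_below_curve_costs[OF h]) (auto simp: curve_costs_def)
  also have "\<dots> \<le> c"
    unfolding c
    by (intro add_left_mono integral_le eikonal.integrable_h_curve[OF h] eikonal.integrable_h_curve[OF k] \<gamma> le)
  finally show "eikonal_envelope f h x \<le> c" .
qed

lemma eikonal_envelope_tendsto:
  fixes f g :: "'a::{real_normed_vector,heine_borel} \<Rightarrow> real"
    and gs :: "nat \<Rightarrow> 'a \<Rightarrow> real"
  assumes eik: "\<And>i. eikonal f (gs i) L R" and "L > 0"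
    and mono: "\<And>i x. gs i x \<le> gs (Suc i) x"
    and lim: "\<And>x. (\<lambda>i. gs i x) \<longlonglongrightarrow> g x" and pos: "\<And>x. 0 < g x"
    and ug: "upper_gradient (\<lambda>x. ennreal (g x)) f"
  shows "(\<lambda>i. eikonal_envelope f (gs i) x) \<longlonglongrightarrow> f x"
proof (rule ccontr)
  let ?F = "\<lambda>i. eikonal_envelope f (gs i) x"
  have f_lip: "L-lipschitz_on UNIV f" using eikonal.f_lip[OF eik] .
  have cont: "continuous_on UNIV (gs i)" for i using eikonal.h_cont[OF eik] .
  have nonneg: "0 \<le> gs i y" for i y using eikonal.h_nonneg[OF eik] .
  have le: "gs i y \<le> L" for i y using eikonal.h_le[OF eik] .
  have out: "gs i y = L" if "y \<notin> ball 0 R" for i y using eikonal.h_outside[OF eik that] .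
  have inc: "gs i y \<le> gs j y" if "i \<le> j" for i j y
    using lift_Suc_mono_le[of "\<lambda>i. gs i y"] mono that by blast
  have Finc: "?F i \<le> ?F j" if "i \<le> j" for i j
    by (rule eikonal_envelope_mono[OF eik eik inc[OF that]])
  have Fle: "?F i \<le> f x" for i using eikonal.eikonal_envelope_le[OF eik] .
  assume "\<not> ?F \<longlonglongrightarrow> f x"
  then obtain e where e: "e > 0" "\<And>N. \<exists>i\<ge>N. \<not> \<bar>?F i - f x\<bar> < e"
    unfolding LIMSEQ_def dist_real_def by blast
  \<comment> \<open>A gap of at least \<open>e\<close> at some later index passes back to
    \<open>i\<close> by monotonicity; halving \<open>e\<close> makes the inequality strict.\<close>
  have Flt: "?F i < f x - e / 2" for i
  proof -
    obtain j where "j \<ge> i" "\<not> \<bar>?F j - f x\<bar> < e" using e(2) by blast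
    then show ?thesis using Finc[of i j] Fle[of j] e(1) by linarith
  qed
  obtain c i0 where c: "c > 0" "\<And>i y. i \<ge> i0 \<Longrightarrow> c \<le> gs i y"
    using increasing_eventually_bounded_away[OF cont mono lim pos out \<open>L > 0\<close>] by blast
  obtain m where m: "\<And>y. y \<in> cball 0 R \<Longrightarrow> m \<le> f y"
    using eikonal.f_bounded_below_cball[OF eik] by blast
  \<comment> \<open>A curve that ends in the ball at time \<open>\<tau>\<close> costs at least
    \<open>m + c * \<tau>\<close>, and the relevant ones cost less than \<open>f x\<close>. The
    shift by \<open>i0\<close> below makes \<open>c\<close> available for every
    \<open>i\<close>.\<close>
  define M where "M = (f x - m) / c"
  have "\<exists>\<gamma> T. 0 \<le> T \<and> T \<le> M \<and> 1-lipschitz_on UNIV \<gamma> \<and> \<gamma> 0 = x \<and>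
      f (\<gamma> T) + integral {0..T} (\<lambda>s. gs (i + i0) (\<gamma> s)) < f x - e / 2" for i
  proof -
    let ?h = "gs (i + i0)"
    obtain \<gamma> and T :: real where \<gamma>: "0 \<le> T" "1-lipschitz_on UNIV \<gamma>" "\<gamma> 0 = x"
      and lt: "f (\<gamma> T) + integral {0..T} (\<lambda>s. ?h (\<gamma> s)) < f x - e / 2"
      using cInf_lessD[OF _ Flt[of "i + i0", unfolded eikonal_envelope_def]] self_in_curve_costs[of f x ?h]
      unfolding curve_costs_def by blast
    \<comment> \<open>The other alternative of \<open>cost_last_exit\<close> would make the cost at
      least \<open>f x\<close>.\<close>
    then obtain \<tau> where \<tau>: "0 \<le> \<tau>" "\<gamma> \<tau> \<in> cball 0 R"
      "f (\<gamma> \<tau>) + integral {0..\<tau>} (\<lambda>s. ?h (\<gamma> s)) < f x - e / 2"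
      using eikonal.cost_last_exit[OF eik \<gamma>(2,1), of "i + i0"] e(1) by force
    have "integral {0..\<tau>} (\<lambda>s. c) \<le> integral {0..\<tau>} (\<lambda>s. ?h (\<gamma> s))"
      by (intro integral_le eikonal.integrable_h_curve[OF eik] \<gamma> c(2)) auto
    then have "c * \<tau> \<le> f x - m"
      using \<tau>(1,3) m[OF \<tau>(2)] e(1) by (simp add: mult.commute)
    then have "\<tau> \<le> M" using c(1) by (simp add: M_def field_simps)
    with \<tau> \<gamma> show ?thesis by blast
  qed
  then obtain \<gamma> and T :: "nat \<Rightarrow> real" where T: "\<And>i. 0 \<le> T i" "\<And>i. T i \<le> M"
    and \<gamma>: "\<And>i. 1-lipschitz_on UNIV (\<gamma> i)" "\<And>i. \<gamma> i 0 = x"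
    and cost: "\<And>i. f (\<gamma> i (T i)) + integral {0..T i} (\<lambda>s. gs (i + i0) (\<gamma> i s)) < f x - e / 2"
    by metis
  obtain r \<gamma>' T' where r: "strict_mono (r :: nat \<Rightarrow> nat)" and \<gamma>': "1-lipschitz_on {0..M} \<gamma>'" "\<gamma>' 0 = x"
    and T': "0 \<le> T'" "T' \<le> M" "(\<lambda>i. T (r i)) \<longlonglongrightarrow> T'"
    and conv: "\<And>s. s \<in> {0..M} \<Longrightarrow> (\<lambda>i. \<gamma> (r i) s) \<longlonglongrightarrow> \<gamma>' s"
    using lipschitz_curves_subsequence[of \<gamma> x T M, OF \<gamma> T] that by blast
  have isCont_f: "isCont f y" for y
    using lipschitz_on_continuous_on[OF f_lip] by (simp add: continuous_on_eq_continuous_at)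
  \<comment> \<open>With \<open>j\<close> fixed, the weight \<open>gs j\<close> is below the weights
    of all later curves. Moving the stopping time from \<open>T (r i)\<close> to \<open>T'\<close>
    changes the terminal value and the integral by at most
    \<open>L * \<bar>T (r i) - T'\<bar>\<close> each in the relevant direction, hence the factor
    2.\<close>
  have bound: "f (\<gamma>' T') + integral {0..T'} (\<lambda>s. gs j (\<gamma>' s)) \<le> f x - e / 2" for j
  proof (rule LIMSEQ_le_const2)
    have i1: "(\<lambda>s. gs j (\<gamma> i s)) integrable_on {u..v}" for i u v
      using eikonal.integrable_h_curve[OF eik \<gamma>(1)] .
    have "(\<lambda>i. integral {0..T'} (\<lambda>s. gs j (\<gamma> (r i) s))) \<longlonglongrightarrow> integral {0..T'} (\<lambda>s. gs j (\<gamma>' s))"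
    proof (rule dominated_convergence(2)[where h = "\<lambda>_. L"])
      show "(\<lambda>i. gs j (\<gamma> (r i) s)) \<longlonglongrightarrow> gs j (\<gamma>' s)" if "s \<in> {0..T'}" for s
        using cont[of j] conv[of s] that T'(2)
        by (intro isCont_tendsto_compose[of _ "gs j"]) (auto simp: continuous_on_eq_continuous_at)
    qed (use i1 nonneg le in auto)
    moreover have dT: "(\<lambda>i. \<bar>T (r i) - T'\<bar>) \<longlonglongrightarrow> 0"
      using tendsto_rabs_zero[OF LIM_zero[OF T'(3)]] .
    moreover have "(\<lambda>i. f (\<gamma> (r i) T')) \<longlonglongrightarrow> f (\<gamma>' T')"
      using conv[of T'] T'(1,2) by (intro isCont_tendsto_compose[OF isCont_f]) auto
    ultimately have "(\<lambda>i. f (\<gamma> (r i) T') + integral {0..T'} (\<lambda>s. gs j (\<gamma> (r i) s)) - 2 * L * \<bar>T (r i) - T'\<bar>)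
        \<longlonglongrightarrow> f (\<gamma>' T') + integral {0..T'} (\<lambda>s. gs j (\<gamma>' s)) - 2 * L * 0"
      by (intro tendsto_intros)
    then show "(\<lambda>i. f (\<gamma> (r i) T') + integral {0..T'} (\<lambda>s. gs j (\<gamma> (r i) s)) - 2 * L * \<bar>T (r i) - T'\<bar>)
        \<longlonglongrightarrow> f (\<gamma>' T') + integral {0..T'} (\<lambda>s. gs j (\<gamma>' s))"
      by simp
    have "f (\<gamma> (r i) T') + integral {0..T'} (\<lambda>s. gs j (\<gamma> (r i) s)) - 2 * L * \<bar>T (r i) - T'\<bar> \<le> f x - e / 2"
      if "i \<ge> j" for i
    proof -
      let ?\<gamma> = "\<gamma> (r i)" and ?T = "T (r i)"
      have "j \<le> r i + i0" using that seq_suble[OF r, of i] by simp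
      then have 1: "integral {0..?T} (\<lambda>s. gs j (?\<gamma> s)) \<le> integral {0..?T} (\<lambda>s. gs (r i + i0) (?\<gamma> s))"
        by (intro integral_le eikonal.integrable_h_curve[OF eik] \<gamma> inc)
      have 2: "integral {0..T'} (\<lambda>s. gs j (?\<gamma> s)) \<le> integral {0..?T} (\<lambda>s. gs j (?\<gamma> s)) + L * \<bar>?T - T'\<bar>"
      proof (cases "T' \<le> ?T")
        case True
        then have "integral {0..T'} (\<lambda>s. gs j (?\<gamma> s)) \<le> integral {0..?T} (\<lambda>s. gs j (?\<gamma> s))"
          by (intro integral_subset_le i1) (auto simp: nonneg)
        moreover have "0 \<le> L * \<bar>?T - T'\<bar>" using \<open>L > 0\<close> by simp
        ultimately show ?thesis by linarith
      next
        case False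
        have "integral {?T..T'} (\<lambda>s. gs j (?\<gamma> s)) \<le> integral {?T..T'} (\<lambda>s. L)"
          by (intro integral_le i1) (auto simp: le)
        also have "\<dots> = L * \<bar>?T - T'\<bar>" using False by simp
        finally show ?thesis
          using Henstock_Kurzweil_Integration.integral_combine[OF T(1)[of "r i"] _ i1, of T' "r i"] False by simp
      qed
      have "f (?\<gamma> T') - f (?\<gamma> ?T) \<le> L * dist (?\<gamma> T') (?\<gamma> ?T)"
        using lipschitz_onD[OF f_lip, of "?\<gamma> T'" "?\<gamma> ?T"] by (simp add: dist_real_def)
      also have "\<dots> \<le> L * \<bar>?T - T'\<bar>"
        using lipschitz_onD[OF \<gamma>(1), of T' ?T "r i"] \<open>L > 0\<close>
        by (intro mult_left_mono) (auto simp: dist_real_def)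
      finally show ?thesis using 1 2 cost[of "r i"] by linarith
    qed
    then show "\<exists>N. \<forall>i\<ge>N. f (\<gamma> (r i) T') + integral {0..T'} (\<lambda>s. gs j (\<gamma> (r i) s)) - 2 * L * \<bar>T (r i) - T'\<bar> \<le> f x - e / 2"
      by blast
  qed
  have lip': "1-lipschitz_on {0..T'} \<gamma>'"
    using \<gamma>'(1) T'(2) by (auto intro: lipschitz_on_subset)
  have "ennreal \<bar>f (\<gamma>' 0) - f (\<gamma>' T')\<bar> \<le> line_integral \<gamma>' 0 T' (\<lambda>x. ennreal (g x))"
    using ug arclength_lipschitz_curve(1)[OF lip' T'(1)] unfolding upper_gradient_def by blast
  also have "\<dots> = (SUP j. line_integral \<gamma>' 0 T' (\<lambda>x. ennreal (gs j x)))"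
    by (rule line_integral_increasing_limit[OF lip' T'(1) cont mono lim])
  also have "\<dots> \<le> ennreal (f x - e / 2 - f (\<gamma>' T'))"
  proof (rule SUP_least)
    fix j
    have "line_integral \<gamma>' 0 T' (\<lambda>x. ennreal (gs j x)) \<le> ennreal (integral {0..T'} (\<lambda>t. gs j (\<gamma>' t)))"
      by (rule line_integral_lipschitz_curve_le[OF lip' T'(1) cont nonneg])
    also have "\<dots> \<le> ennreal (f x - e / 2 - f (\<gamma>' T'))"
      using bound[of j] by (intro ennreal_leI) simp
    finally show "line_integral \<gamma>' 0 T' (\<lambda>x. ennreal (gs j x)) \<le> ennreal (f x - e / 2 - f (\<gamma>' T'))" .
  qed
  \<comment> \<open>The second alternative accounts for \<open>ennreal\<close> truncating a negative
    right-hand side. Both contradict \<open>bound\<close>, which gives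
    \<open>f x - f (\<gamma>' T') \<ge> e / 2\<close>.\<close>
  finally have "\<bar>f x - f (\<gamma>' T')\<bar> \<le> f x - e / 2 - f (\<gamma>' T') \<or> f x - f (\<gamma>' T') = 0 \<and> f x - e / 2 - f (\<gamma>' T') \<le> 0"
    using \<gamma>'(2) by (auto simp: ennreal_le_iff2)
  moreover have "0 \<le> integral {0..T'} (\<lambda>t. gs 0 (\<gamma>' t))"
    by (intro integral_nonneg integrable_continuous_interval eikonal.continuous_on_h_curve[OF eik] lip') (simp add: nonneg)
  ultimately show False using bound[of 0] e(1) by linarith
qed

section \<open>The envelopes of the given weights as approximating sequence\<close>

theorem proposition3p15:
  fixes f g :: "real ^ 'n \<Rightarrow> real"
    and gs :: "nat \<Rightarrow> real ^ 'n \<Rightarrow> real"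
    and R :: real
  assumes "\<exists>L. L-lipschitz_on UNIV f"
    and "LIP UNIV f > 0"
    and "\<And>x. 0 < g x"
    and "\<And>x. ennreal (g x) \<le> LIP UNIV f"
    and "lower_semicontinuous g"
    and "upper_gradient (\<lambda>x. ennreal (g x)) f"
    and "R > 0"
    and "\<And>x. x \<notin> ball 0 R \<Longrightarrow> ennreal (g x) = LIP UNIV f"
    and "\<And>i. continuous_on UNIV (gs i)"
    and "\<And>i x. 0 \<le> gs i x"
    and "\<And>i x. gs i x \<le> gs (Suc i) x"
    and "\<And>x. (\<lambda>i. gs i x) \<longlonglongrightarrow> g x"
    and "\<And>i x. x \<notin> ball 0 R \<Longrightarrow> ennreal (gs i x) = LIP UNIV f"
  shows "\<exists>fs :: nat \<Rightarrow> real ^ 'n \<Rightarrow> real.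
           (\<forall>i. LIP UNIV (fs i) \<le> LIP UNIV f) \<and>
           weak_star_converges fs f \<and>
           (\<forall>i x. Lip_a (fs i) x \<le> ennreal (gs i x))"
proof -
  define L where "L = enn2real (LIP UNIV f)"
  have "LIP UNIV f < \<infinity>"
    using assms(1) lipschitz_on_iff_LIP_le lipschitz_on_nonneg
    by (metis ennreal_less_top infinity_ennreal_def order.strict_trans1)
  then have LIP: "LIP UNIV f = ennreal L" by (simp add: L_def less_top)
  have L: "L > 0" using assms(2) LIP by simp
  have f_lip: "L-lipschitz_on UNIV f" using L LIP by (simp add: lipschitz_on_iff_LIP_le)
  have gs_le: "gs i x \<le> L" for i x
  proof -
    have "gs i x \<le> g x"
      by (rule incseq_le[OF incseq_SucI assms(12)]) (rule assms(11))
    also have "g x \<le> L" using assms(4)[of x] L by (simp add: LIP)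
    finally show ?thesis .
  qed
  have out: "gs i x = L" if "x \<notin> ball 0 R" for i x
    using assms(13)[OF that, of i] assms(10)[of i x] L by (simp add: LIP)
  have eik: "eikonal f (gs i) L R" for i
    by unfold_locales (fact f_lip assms gs_le out)+
  define fs where "fs i = eikonal_envelope f (gs i)" for i
  \<comment> \<open>The whole space is convex and \<open>gs i \<le> L\<close> on it, so the local
    slope bound becomes a global one.\<close>
  have lip: "L-lipschitz_on UNIV (fs i)" for i
    unfolding fs_def using L gs_le by (intro eikonal.eikonal_envelope_lipschitz_on[OF eik]) auto
  then have LIP_le: "LIP UNIV (fs i) \<le> LIP UNIV f" for i
    using L LIP by (simp add: lipschitz_on_iff_LIP_le)
  have "(SUP i. LIP UNIV (fs i)) \<le> LIP UNIV f" by (intro SUP_least LIP_le)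
  then have "(SUP i. LIP UNIV (fs i)) < \<infinity>"
    using \<open>LIP UNIV f < \<infinity>\<close> by (rule le_less_trans)
  moreover have "(\<lambda>i. fs i x) \<longlonglongrightarrow> f x" for x
    unfolding fs_def by (rule eikonal_envelope_tendsto[OF eik L assms(11,12,3,6)])
  ultimately have "weak_star_converges fs f"
    unfolding weak_star_converges_def using lip f_lip by blast
  moreover have "Lip_a (fs i) x \<le> ennreal (gs i x)" for i x
    unfolding fs_def by (rule eikonal.Lip_a_eikonal_envelope_le[OF eik])
  ultimately show ?thesis using LIP_le by blast
qed

end
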